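(* A precise solution of Problem EE* for the self-conjugate balanced complex polytope gives an approximate solution to Problem EE with factor $q\ge\frac12$. That is, let $\boldsymbol v_0,\ldots,\boldsymbol v_N\in\mathbb C^d$, $E_k=E(\boldsymbol v_k)$ for $k=0,\ldots,N$, $P=\mathrm{co}\{E_1,\ldots,E_N\}$ and $G=\mathrm{cob}\{\boldsymbol v_1,\ldots,\boldsymbol v_N,\bar{\boldsymbol v}_1,\ldots,\bar{\boldsymbol v}_N\}$. If $\frac12\boldsymbol v_0\notin G$, then $E_0\not\subset P$; and if $\frac12\boldsymbol v_0\in G$, then $\frac12E_0\subset P$.
   Context: For $\boldsymbol v=\boldsymbol a+i\boldsymbol b\in\mathbb C^d$ with $\boldsymbol a,\boldsymbol b\in\mathbb R^d$, $E(\boldsymbol v)=\{\boldsymbol a\cos t+\boldsymbol b\sin t : t\in\mathbb R\}\subset\mathbb R^d$ and $\bar{\boldsymbol v}=\boldsymbol a-i\boldsymbol b$. $\mathrm{co}$ denotes the convex hull of the union of the listed sets. The balanced convex hull of $K\subset\mathbb C^d$ is $$\mathrm{cob}(K)=\Big\{\sum_{k=1}^n z_k\boldsymbol v_k : n\in\mathbb N,\ z_k\in\mathbb C,\ \boldsymbol v_k\in K,\ \sum_{k=1}^n|z_k|\le1\Big\}.$$ Problem EE: decide whether $E_0\subset P$. Problem EE* (for $G$): decide whether a given point of $\mathbb C^d$ belongs to $G$. A method solves Problem EE approximately with a factor $q\in[0,1]$ if it decides between the two cases: either $E_0\not\subset P$ or $qE_0\subset P$. *)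

theory Defs
  imports "HOL-Analysis.Analysis"
begin

definition Re_vec :: "complex ^ 'd \<Rightarrow> real ^ 'd" where
  "Re_vec v = (\<chi> i. Re (v $ i))"

definition Im_vec :: "complex ^ 'd \<Rightarrow> real ^ 'd" where
  "Im_vec v = (\<chi> i. Im (v $ i))"

definition cnj_vec :: "complex ^ 'd \<Rightarrow> complex ^ 'd" where
  "cnj_vec v = (\<chi> i. cnj (v $ i))"

definition ellipse :: "complex ^ 'd \<Rightarrow> (real ^ 'd) set" where
  "ellipse v = {cos t *\<^sub>R Re_vec v + sin t *\<^sub>R Im_vec v | t :: real. True}"

text \<open>Balanced convex hull. Requiring \<open>n \<ge> 1\<close> rather than \<open>n \<ge> 0\<close> only matters for empty \<open>K\<close>.\<close>

definition cob :: "(complex ^ 'd) set \<Rightarrow> (complex ^ 'd) set" where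
  "cob K = {\<Sum>k = 1..n. z k *s u k | (n :: nat) (z :: nat \<Rightarrow> complex) (u :: nat \<Rightarrow> complex ^ 'd).
     1 \<le> n \<and> (\<forall>k\<in>{1..n}. u k \<in> K) \<and> (\<Sum>k = 1..n. cmod (z k)) \<le> 1}"

definition ellipse_polytope :: "nat \<Rightarrow> (nat \<Rightarrow> complex ^ 'd) \<Rightarrow> (real ^ 'd) set" where
  "ellipse_polytope N v = convex hull (\<Union>k\<in>{1..N}. ellipse (v k))"

definition self_conj_polytope :: "nat \<Rightarrow> (nat \<Rightarrow> complex ^ 'd) \<Rightarrow> (complex ^ 'd) set" where
  "self_conj_polytope N v = cob (v ` {1..N} \<union> (\<lambda>k. cnj_vec (v k)) ` {1..N})"

text \<open>
  A method is represented by its answers: a predicate on the queried vector. For Problem EE the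
  query \<open>w\<close> stands for the ellipse \<open>E\<^sub>0 = ellipse w\<close>; the answer \<open>True\<close> asserts
  \<open>q E\<^sub>0 \<subseteq> P\<close> and \<open>False\<close> asserts that \<open>E\<^sub>0\<close> is not contained in \<open>P\<close>.
\<close>

definition solves_EE_star :: "(complex ^ 'd) set \<Rightarrow> (complex ^ 'd \<Rightarrow> bool) \<Rightarrow> bool" where
  "solves_EE_star G A \<longleftrightarrow> (\<forall>w. A w \<longleftrightarrow> w \<in> G)"

definition solves_EE_approx :: "real \<Rightarrow> (real ^ 'd) set \<Rightarrow> (complex ^ 'd \<Rightarrow> bool) \<Rightarrow> bool" where
  "solves_EE_approx q P A \<longleftrightarrow> 0 \<le> q \<and> q \<le> 1 \<and>
     (\<forall>w. (A w \<longrightarrow> (\<lambda>x. q *\<^sub>R x) ` ellipse w \<subseteq> P) \<and> (\<not> A w \<longrightarrow> \<not> ellipse w \<subseteq> P))"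

end

theory Submission
  imports Defs
begin

text \<open>
  The points of \<^term>\<open>ellipse w\<close> are the real parts of the rotations of \<^term>\<open>w\<close>, and \<^term>\<open>w\<close> and
  its conjugate span the same ellipse. Hence if \<open>w = \<Sum>k. z\<^sub>k u\<^sub>k\<close> with \<open>\<Sum>k. \<bar>z\<^sub>k\<bar> \<le> 1\<close>,
  every point of its ellipse is a subconvex combination of points on the ellipses of the \<open>u\<^sub>k\<close>,
  which yields \<open>w \<in> G \<Longrightarrow> ellipse w \<subseteq> P\<close>. Conversely, the real part of a rotation of \<open>v\<^sub>k\<close> is the
  midpoint of a rotation of \<open>v\<^sub>k\<close> and a rotation of its conjugate, so \<open>P \<subseteq> G\<close> for real vectors
  viewed as complex ones. If \<open>ellipse w \<subseteq> P\<close>, then the real and imaginary parts \<open>x\<close> and \<open>y\<close> of \<open>w\<close>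
  lie in \<open>G\<close>, and so does the midpoint of \<open>x\<close> and \<open>\<i> y\<close>, which is half of \<open>w\<close>.
\<close>

section \<open>Real vectors and ellipses\<close>

definition complex_vec :: "real ^ 'd \<Rightarrow> complex ^ 'd" where
  "complex_vec x = (\<chi> i. of_real (x $ i))"

lemma linear_complex_vec: "linear complex_vec"
  by (rule linearI) (simp_all add: complex_vec_def vec_eq_iff complex_eq_iff)

lemma linear_Re_vec: "linear Re_vec"
  by (rule linearI) (simp_all add: Re_vec_def vec_eq_iff)

text \<open>Rotation by \<open>cis t\<close> runs through the defining parametrization backwards;
  surjectivity of negation absorbs the sign.\<close>

lemma ellipse_eq: "ellipse w = range (\<lambda>t. Re_vec (cis t *s w))"
proof -
  have *: "cos t *\<^sub>R Re_vec w + sin t *\<^sub>R Im_vec w = Re_vec (cis (- t) *s w)" for t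
    by (simp add: Re_vec_def Im_vec_def vec_eq_iff)
  have "ellipse w = range ((\<lambda>t. Re_vec (cis t *s w)) \<circ> uminus)"
    by (auto simp: ellipse_def *)
  then show ?thesis
    by (metis image_comp surj_uminus)
qed

lemma Re_vec_in_ellipse: "Re_vec w \<in> ellipse w"
  by (auto simp: ellipse_def intro!: exI[of _ 0])

lemma Im_vec_in_ellipse: "Im_vec w \<in> ellipse w"
  by (auto simp: ellipse_def intro!: exI[of _ "pi/2"])

lemma ellipse_cnj_vec: "ellipse (cnj_vec w) = ellipse w"
proof -
  have *: "Re_vec (cis t *s cnj_vec w) = Re_vec (cis (- t) *s w)" for t
    by (simp add: Re_vec_def cnj_vec_def vec_eq_iff)
  have "ellipse (cnj_vec w) = range ((\<lambda>t. Re_vec (cis t *s w)) \<circ> uminus)"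
    by (auto simp: ellipse_eq *)
  then show ?thesis
    by (metis ellipse_eq image_comp surj_uminus)
qed

lemma uminus_in_ellipse:
  assumes "x \<in> ellipse w"
  shows "- x \<in> ellipse w"
proof -
  from assms obtain t where "x = cos t *\<^sub>R Re_vec w + sin t *\<^sub>R Im_vec w"
    by (auto simp: ellipse_def)
  then have "- x = cos (t + pi) *\<^sub>R Re_vec w + sin (t + pi) *\<^sub>R Im_vec w"
    by simp
  then show ?thesis
    unfolding ellipse_def by blast
qed

lemma scaleR_image_ellipse: "(\<lambda>x. c *\<^sub>R x) ` ellipse w = ellipse (c *\<^sub>R w)"
proof -
  have "Re_vec (z *s (c *\<^sub>R w)) = c *\<^sub>R Re_vec (z *s w)" for z
    by (simp add: Re_vec_def vec_eq_iff algebra_simps)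
  then show ?thesis
    by (simp add: ellipse_eq image_image)
qed

text \<open>By the polar form of \<open>z\<close>, the phase only moves the point along the ellipse
  and the modulus scales it. At \<open>z = 0\<close> any value of \<open>Arg\<close> would
  do.\<close>

lemma Re_vec_mult_in_ellipse:
  "\<exists>p\<in>ellipse u. Re_vec (z *s u) = cmod z *\<^sub>R p"
proof
  show "Re_vec (cis (Arg z) *s u) \<in> ellipse u"
    by (simp add: ellipse_eq)
  have "z = complex_of_real (cmod z) * cis (Arg z)"
    by (metis rcis_cmod_Arg rcis_def)
  moreover have "(complex_of_real r * c) *s u = r *\<^sub>R (c *s u)" for r c
    by (simp add: vec_eq_iff complex_eq_iff algebra_simps)
  ultimately have "z *s u = cmod z *\<^sub>R (cis (Arg z) *s u)"
    by metis
  then show "Re_vec (z *s u) = cmod z *\<^sub>R Re_vec (cis (Arg z) *s u)"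
    by (simp add: linear_cmul[OF linear_Re_vec])
qed

text \<open>The missing weight \<open>1 - sum c I\<close> goes to the origin. Total weight zero is
  split off because the weights are normalized by division.\<close>

lemma convex_subconvex_sum:
  assumes "convex S" "0 \<in> S" "finite I" "sum c I \<le> 1"
    and "\<And>i. i \<in> I \<Longrightarrow> 0 \<le> c i" "\<And>i. i \<in> I \<Longrightarrow> p i \<in> S"
  shows "(\<Sum>i\<in>I. c i *\<^sub>R p i) \<in> S"
proof (cases "sum c I = 0")
  case True
  then have "\<forall>i\<in>I. c i = 0"
    using assms(3,5) by (simp add: sum_nonneg_eq_0_iff)
  then show ?thesis
    using assms(2) by simp
next
  case False
  moreover have "0 \<le> sum c I"
    using assms(5) by (rule sum_nonneg)
  ultimately have pos: "0 < sum c I"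
    by simp
  have "(\<Sum>i\<in>I. (c i / sum c I) *\<^sub>R p i) \<in> S"
    using assms pos by (intro convex_sum) (auto simp flip: sum_divide_distrib)
  then have "sum c I *\<^sub>R (\<Sum>i\<in>I. (c i / sum c I) *\<^sub>R p i) + (1 - sum c I) *\<^sub>R 0 \<in> S"
    using assms(1,2,4) pos by (intro convexD) auto
  then show ?thesis
    using pos by (simp add: scaleR_sum_right)
qed

section \<open>Balanced convex hulls\<close>

lemma cobI:
  fixes n :: nat
  assumes "1 \<le> n" "u ` {1..n} \<subseteq> K" "(\<Sum>k = 1..n. cmod (z k)) \<le> 1"
  shows "(\<Sum>k = 1..n. z k *s u k) \<in> cob K"
  using assms unfolding cob_def image_subset_iff by blast

lemma cobE:
  assumes "w \<in> cob K"
  obtains n :: nat and u z where "1 \<le> n" "u ` {1..n} \<subseteq> K"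
    "(\<Sum>k = 1..n. cmod (z k)) \<le> 1" "w = (\<Sum>k = 1..n. z k *s u k)"
  using assms unfolding cob_def image_subset_iff by blast

lemma cob_smult:
  assumes "w \<in> cob K" "cmod c \<le> 1"
  shows "c *s w \<in> cob K"
proof -
  from assms(1) obtain n :: nat and u z where *: "1 \<le> n" "u ` {1..n} \<subseteq> K"
    "(\<Sum>k = 1..n. cmod (z k)) \<le> 1" "w = (\<Sum>k = 1..n. z k *s u k)"
    by (rule cobE)
  have "(\<Sum>k = 1..n. cmod (c * z k)) = cmod c * (\<Sum>k = 1..n. cmod (z k))"
    by (simp add: norm_mult sum_distrib_left)
  also have "\<dots> \<le> 1"
    using assms(2) *(3) by (simp add: mult_le_one sum_nonneg)
  finally have "(\<Sum>k = 1..n. (c * z k) *s u k) \<in> cob K"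
    using *(1,2) by (intro cobI)
  then show ?thesis
    by (simp add: *(4) vec.scale_sum_right)
qed

lemma cob_superset: "K \<subseteq> cob K"
proof
  fix w assume "w \<in> K"
  then show "w \<in> cob K"
    using cobI[of 1 "\<lambda>_. w" K "\<lambda>_. 1"] by simp
qed

lemma convex_cob:
  fixes K :: "(complex ^ 'd) set"
  shows "convex (cob K)"
proof (rule convexI)
  fix x y and a b :: real
  assume ab: "0 \<le> a" "0 \<le> b" "a + b = 1"
  assume "x \<in> cob K"
  then obtain n :: nat and u z where x: "1 \<le> n" "u ` {1..n} \<subseteq> K"
    "(\<Sum>k = 1..n. cmod (z k)) \<le> 1" "x = (\<Sum>k = 1..n. z k *s u k)"
    by (rule cobE)
  assume "y \<in> cob K"
  then obtain m :: nat and u' z' where y: "1 \<le> m" "u' ` {1..m} \<subseteq> K"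
    "(\<Sum>k = 1..m. cmod (z' k)) \<le> 1" "y = (\<Sum>k = 1..m. z' k *s u' k)"
    by (rule cobE)
  \<comment> \<open>The two representations are concatenated: indices above \<open>n\<close> are
    shifted back into the second one.\<close>
  define s where "s k = (if k \<le> n then a *\<^sub>R z k else b *\<^sub>R z' (k - n))" for k
  define r where "r k = (if k \<le> n then u k else u' (k - n))" for k
  have split: "(\<Sum>k = 1..n + m. f k) = (\<Sum>k = 1..n. f k) + (\<Sum>k = 1..m. f (k + n))"
    for f :: "nat \<Rightarrow> 'c :: comm_monoid_add"
    using sum.ub_add_nat[of 1 n f m] sum.shift_bounds_cl_nat_ivl[of f 1 n m]
    by (simp add: add.commute)
  have "(\<Sum>k = 1..n + m. cmod (s k)) = a * (\<Sum>k = 1..n. cmod (z k)) + b * (\<Sum>k = 1..m. cmod (z' k))"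
    unfolding split using ab(1,2) by (simp add: s_def sum_distrib_left)
  also have "\<dots> \<le> 1"
    using ab x(3) y(3) by (intro convex_bound_le)
  finally have "(\<Sum>k = 1..n + m. cmod (s k)) \<le> 1" .
  moreover have "r k \<in> K" if "k \<in> {1..n + m}" for k
  proof (cases "k \<le> n")
    case True
    then show ?thesis
      using x(2) that by (auto simp: r_def)
  next
    case False
    then have "k - n \<in> {1..m}"
      using that by auto
    then show ?thesis
      using y(2) False by (auto simp: r_def)
  qed
  ultimately have "(\<Sum>k = 1..n + m. s k *s r k) \<in> cob K"
    using x(1) by (intro cobI) auto
  moreover have "(\<Sum>k = 1..n + m. s k *s r k) = a *\<^sub>R x + b *\<^sub>R y"
  proof -
    have "(c *\<^sub>R q) *s w = c *\<^sub>R (q *s w)" for c q and w :: "complex ^ 'd"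
      by (simp add: vec_eq_iff)
    then show ?thesis
      unfolding split by (simp add: s_def r_def x(4) y(4) scaleR_sum_right)
  qed
  ultimately show "a *\<^sub>R x + b *\<^sub>R y \<in> cob K"
    by simp
qed

section \<open>The two inclusions between ellipses and balanced hulls\<close>

lemma ellipse_subset_if_mem_cob:
  assumes "convex S" "0 \<in> S" "\<And>u. u \<in> K \<Longrightarrow> ellipse u \<subseteq> S" "w \<in> cob K"
  shows "ellipse w \<subseteq> S"
proof -
  \<comment> \<open>Real parts suffice: \<open>cob K\<close> is closed under rotations, and these
    sweep out the whole ellipse.\<close>
  have "Re_vec w' \<in> S" if "w' \<in> cob K" for w'
  proof -
    from that obtain n :: nat and u z where w': "1 \<le> n" "u ` {1..n} \<subseteq> K"
      "(\<Sum>k = 1..n. cmod (z k)) \<le> 1" "w' = (\<Sum>k = 1..n. z k *s u k)"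
      by (rule cobE)
    obtain p where p: "\<And>k. p k \<in> ellipse (u k)" "\<And>k. Re_vec (z k *s u k) = cmod (z k) *\<^sub>R p k"
      using Re_vec_mult_in_ellipse[of "u k" "z k" for k] by metis
    have "p k \<in> S" if "k \<in> {1..n}" for k
      using assms(3) w'(2) p(1) that by blast
    then have "(\<Sum>k = 1..n. cmod (z k) *\<^sub>R p k) \<in> S"
      using assms(1,2) w'(3) by (intro convex_subconvex_sum) auto
    then show ?thesis
      by (simp add: w'(4) linear_sum[OF linear_Re_vec] p(2))
  qed
  moreover have "cis t *s w \<in> cob K" for t
    using assms(4) by (intro cob_smult) auto
  ultimately show ?thesis
    by (auto simp: ellipse_eq)
qed

lemma convex_hull_ellipses_subset_cob:
  assumes "\<And>u. u \<in> K \<Longrightarrow> cnj_vec u \<in> K"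
  shows "complex_vec ` (convex hull (\<Union>u\<in>K. ellipse u)) \<subseteq> cob K"
proof -
  have "complex_vec x \<in> cob K" if u: "u \<in> K" and x: "x \<in> ellipse u" for u x
  proof -
    from x obtain t where t: "x = Re_vec (cis t *s u)"
      by (auto simp: ellipse_eq)
    have "complex_vec x = (1/2) *\<^sub>R (cis t *s u) + (1/2) *\<^sub>R (cis (- t) *s cnj_vec u)"
      by (simp add: t complex_vec_def Re_vec_def cnj_vec_def vec_eq_iff complex_eq_iff field_simps)
    also have "\<dots> \<in> cob K"
      using u assms cob_superset by (intro convexD convex_cob cob_smult) auto
    finally show ?thesis .
  qed
  then show ?thesis
    \<comment> \<open>The embedding commutes with convex hulls, so points of single ellipses
      suffice.\<close>
    unfolding convex_hull_linear_image[OF linear_complex_vec]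
    by (intro hull_minimal convex_cob) auto
qed

lemma half_mem_cob_if_ellipse_subset:
  assumes "\<And>u. u \<in> K \<Longrightarrow> cnj_vec u \<in> K"
    and "ellipse w \<subseteq> convex hull (\<Union>u\<in>K. ellipse u)"
  shows "(1/2) *\<^sub>R w \<in> cob K"
proof -
  have sub: "complex_vec ` ellipse w \<subseteq> cob K"
    using convex_hull_ellipses_subset_cob[OF assms(1)] assms(2) by blast
  \<comment> \<open>The factor 1/2 arises here: in \<open>w\<close> itself the two parts have total
    weight 2.\<close>
  have "(1/2) *\<^sub>R w = (1/2) *\<^sub>R complex_vec (Re_vec w) + (1/2) *\<^sub>R (\<i> *s complex_vec (Im_vec w))"
    by (simp add: complex_vec_def Re_vec_def Im_vec_def vec_eq_iff complex_eq_iff)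
  also have "\<dots> \<in> cob K"
    using sub Re_vec_in_ellipse[of w] Im_vec_in_ellipse[of w]
    by (intro convexD convex_cob cob_smult) auto
  finally show ?thesis .
qed

text \<open>Provides the origin for subconvex combinations, as the midpoint of two antipodal points
  of one ellipse.\<close>

lemma zero_in_convex_hull_ellipses:
  assumes "K \<noteq> {}"
  shows "0 \<in> convex hull (\<Union>u\<in>K. ellipse u)"
proof -
  from assms obtain u where "u \<in> K"
    by blast
  then have "ellipse u \<subseteq> convex hull (\<Union>u\<in>K. ellipse u)"
    by (meson UN_upper hull_subset order_trans)
  then have "Re_vec u \<in> convex hull (\<Union>u\<in>K. ellipse u)" "- Re_vec u \<in> convex hull (\<Union>u\<in>K. ellipse u)"
    using Re_vec_in_ellipse uminus_in_ellipse by blast+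
  then have "(1/2) *\<^sub>R Re_vec u + (1/2) *\<^sub>R (- Re_vec u) \<in> convex hull (\<Union>u\<in>K. ellipse u)"
    by (intro convexD convex_convex_hull) auto
  then show ?thesis
    by simp
qed

theorem theorem6p2:
  fixes v :: "nat \<Rightarrow> complex ^ 'd" and N :: nat
    and P :: "(real ^ 'd) set" and G :: "(complex ^ 'd) set"
  assumes "N \<ge> 1"
    and "P = ellipse_polytope N v"
    and "G = self_conj_polytope N v"
  shows "(\<forall>A. solves_EE_star G A \<longrightarrow> solves_EE_approx (1/2) P (\<lambda>w. A ((1/2) *\<^sub>R w))) \<and>
         ((1/2) *\<^sub>R v 0 \<notin> G \<longrightarrow> \<not> ellipse (v 0) \<subseteq> P) \<and>
         ((1/2) *\<^sub>R v 0 \<in> G \<longrightarrow> (\<lambda>x. (1/2) *\<^sub>R x) ` ellipse (v 0) \<subseteq> P)"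
proof -
  define K where "K = v ` {1..N} \<union> (\<lambda>k. cnj_vec (v k)) ` {1..N}"
  have "cnj_vec (cnj_vec u) = u" for u :: "complex ^ 'd"
    by (simp add: cnj_vec_def)
  then have cnj: "cnj_vec u \<in> K" if "u \<in> K" for u
    using that unfolding K_def by auto
  have G: "G = cob K"
    by (simp add: assms(3) self_conj_polytope_def K_def)
  have "(\<Union>u\<in>K. ellipse u) = (\<Union>k\<in>{1..N}. ellipse (v k))"
    by (simp add: K_def ellipse_cnj_vec)
  then have P: "P = convex hull (\<Union>u\<in>K. ellipse u)"
    by (simp add: assms(2) ellipse_polytope_def)
  have "K \<noteq> {}"
    using assms(1) by (simp add: K_def)
  then have "0 \<in> P"
    unfolding P by (rule zero_in_convex_hull_ellipses)
  moreover have "ellipse u \<subseteq> P" if "u \<in> K" for u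
    unfolding P using that by (meson UN_upper hull_subset order_trans)
  ultimately have inner: "(\<lambda>x. (1/2) *\<^sub>R x) ` ellipse w \<subseteq> P" if "(1/2) *\<^sub>R w \<in> G" for w
    unfolding scaleR_image_ellipse
    \<comment> \<open>Rotating moves the convexity premise to the end, so that the two chained facts
      match the leading premises.\<close>
    by (rule ellipse_subset_if_mem_cob[rotated]) (use that G P in auto)
  have outer: "(1/2) *\<^sub>R w \<in> G" if "ellipse w \<subseteq> P" for w
    unfolding G using cnj that[unfolded P] by (rule half_mem_cob_if_ellipse_subset)
  show ?thesis
    \<comment> \<open>Both inclusions hold for every \<open>w\<close>, hence for all queries of a
      method as well as for \<open>v 0\<close>.\<close>
    unfolding solves_EE_star_def solves_EE_approx_def using inner outer by auto
qed

end
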